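(* Let $J=[0,1]$, let $m\ge 2$ be an integer, let $0<\eta_1<\dots<\eta_m\le 1$, let $\alpha_1,\dots,\alpha_{m-1}\in\mathbb{R}$ and $\beta_1,\dots,\beta_m\in\mathbb{R}$, and assume that $$\mu := 1-\Big(\sum_{i=1}^{m-1}\alpha_i(\eta_{i+1}-\eta_i)+\sum_{i=1}^{m}\beta_i\Big)\neq 0 .$$ Let $f:J\times\mathbb{R}\to\mathbb{R}$ have the form $f(t,u)=p(t)g(u)$, where $p:J\to\mathbb{R}$ and $g:\mathbb{R}\to\mathbb{R}$ are continuous and $$\lim_{|u|\to\infty}\frac{g(u)}{u}=\gamma\quad\text{for some }\gamma\in\mathbb{R},$$ and suppose there exists $t_0\in(0,1]$ with $f(t_0,0)=p(t_0)g(0)\neq 0$. Put $p^{*}=\max_{t\in J}|p(t)|$ and $$M=p^{*}\bigg(1+\frac{1}{|\mu|}\sum_{i=1}^{m-1}|\alpha_i|(\eta_{i+1}-\eta_i)+\frac{1}{|\mu|}\sum_{i=1}^{m}|\beta_i|\bigg)\int_0^1G(1,s)\,ds ,$$ where $G(1,s)=\frac{1}{5!}\big((1-s)^3-(1-s)^5\big)$ for $s\in J$. Assume that $|\gamma|\le \frac{1}{M}$. Then the boundary value problem $$u^{(6)}(t)+f(t,u(t))=0,\quad t\in(0,1),$$ $$u^{(j)}(0)=0\ (1\le j\le 4),\qquad u''(1)=0,\qquad u(0)=\sum_{i=1}^{m-1}\alpha_i\int_{\eta_i}^{\eta_{i+1}}u(s)\,ds+\sum_{i=1}^{m}\beta_i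 u(\eta_i)$$ has at least one nontrivial solution $u\in C(J,\mathbb{R})$.
   Context: A solution of the boundary value problem is a function $u\in C^6([0,1],\mathbb{R})$ (one-sided derivatives at the endpoints) satisfying the differential equation on $(0,1)$ and all the boundary conditions. Nontrivial means not identically zero. *)

theory Defs
  imports "HOL-Analysis.Analysis"
begin

abbreviation J :: "real set" where "J \<equiv> {0..1}"

text \<open>Functions on \<open>J\<close> are total functions on the reals whose values outside \<open>J\<close> play no role.
  Derivatives are taken within \<open>J\<close>: two-sided in the interior, one-sided at the endpoints.\<close>

definition nderiv :: "nat \<Rightarrow> (real \<Rightarrow> real) \<Rightarrow> real \<Rightarrow> real" where
  "nderiv k = (\<lambda>v t. vector_derivative v (at t within J)) ^^ k"

text \<open>\<^const>\<open>vector_derivative\<close> is a choice operator, so differentiability has to be required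
  separately.\<close>

definition C_k :: "nat \<Rightarrow> (real \<Rightarrow> real) \<Rightarrow> bool" where
  "C_k k u \<longleftrightarrow>
     (\<forall>j<k. \<forall>t\<in>J. (nderiv j u has_real_derivative nderiv (Suc j) u t) (at t within J)) \<and>
     continuous_on J (nderiv k u)"

definition bvp_solution ::
  "nat \<Rightarrow> (nat \<Rightarrow> real) \<Rightarrow> (nat \<Rightarrow> real) \<Rightarrow> (nat \<Rightarrow> real) \<Rightarrow> (real \<Rightarrow> real \<Rightarrow> real) \<Rightarrow> (real \<Rightarrow> real) \<Rightarrow> bool"
  where
  "bvp_solution m \<eta> \<alpha> \<beta> f u \<longleftrightarrow>
     C_k 6 u \<and>
     (\<forall>t\<in>{0<..<1}. nderiv 6 u t + f t (u t) = 0) \<and>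
     (\<forall>j\<in>{1..4}. nderiv j u 0 = 0) \<and>
     nderiv 2 u 1 = 0 \<and>
     u 0 = (\<Sum>i=1..m-1. \<alpha> i * integral {\<eta> i..\<eta> (i+1)} u) + (\<Sum>i=1..m. \<beta> i * u (\<eta> i))"

definition nontrivial :: "(real \<Rightarrow> real) \<Rightarrow> bool" where
  "nontrivial u \<longleftrightarrow> (\<exists>t\<in>J. u t \<noteq> 0)"

definition bvp_mu :: "nat \<Rightarrow> (nat \<Rightarrow> real) \<Rightarrow> (nat \<Rightarrow> real) \<Rightarrow> (nat \<Rightarrow> real) \<Rightarrow> real" where
  "bvp_mu m \<eta> \<alpha> \<beta> =
     1 - ((\<Sum>i=1..m-1. \<alpha> i * (\<eta> (i+1) - \<eta> i)) + (\<Sum>i=1..m. \<beta> i))"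

text \<open>The Green's function \<open>G(t,s)\<close> of the problem at \<open>t = 1\<close>.\<close>

definition G1 :: "real \<Rightarrow> real" where
  "G1 s = 1 / fact 5 * ((1 - s)^3 - (1 - s)^5)"

text \<open>For \<open>p\<close> continuous on the compact interval \<open>J\<close> the supremum is the maximum \<open>p\<^sup>*\<close>.\<close>

definition p_star :: "(real \<Rightarrow> real) \<Rightarrow> real" where
  "p_star p = (SUP t\<in>J. \<bar>p t\<bar>)"

definition bvp_M ::
  "nat \<Rightarrow> (nat \<Rightarrow> real) \<Rightarrow> (nat \<Rightarrow> real) \<Rightarrow> (nat \<Rightarrow> real) \<Rightarrow> (real \<Rightarrow> real) \<Rightarrow> real" where
  "bvp_M m \<eta> \<alpha> \<beta> p =
     p_star p *
     (1 + 1 / \<bar>bvp_mu m \<eta> \<alpha> \<beta>\<bar> * (\<Sum>i=1..m-1. \<bar>\<alpha> i\<bar> * (\<eta> (i+1) - \<eta> i))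
        + 1 / \<bar>bvp_mu m \<eta> \<alpha> \<beta>\<bar> * (\<Sum>i=1..m. \<bar>\<beta> i\<bar>)) *
     integral J G1"

end

theory Submission imports Defs "HOL-Complex_Analysis.Great_Picard"
begin

text \<open>
  A solution is a fixed point \<open>u = B v + v\<close>, where \<open>v t = \<integral> G(t,s) p(s) g(u s) ds\<close> and \<open>B v\<close> is
  the nonlocal boundary functional of \<open>v\<close> divided by \<open>\<mu>\<close>.

  For a bounded continuous right-hand side, such a \<open>u\<close> is obtained without Schauder's theorem.
  Replacing \<open>u(s)\<close> by \<open>u(max 0 (s - h))\<close> under the integral makes the Cauchy problem explicitly
  solvable, its solution depending continuously on \<open>u(0)\<close> and on the coefficient of \<open>t^5\<close>.
  Brouwer's theorem in the plane adjusts these two parameters to the boundary conditions, and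
  Arzela-Ascoli lets \<open>h\<close> tend to \<open>0\<close>.

  The function \<open>g\<close> is truncated at the level \<open>R (1 + L + q t)\<close>, where \<open>L\<close> is the norm of \<open>B\<close> and
  \<open>q t = 1440 \<integral> G(t,s) ds\<close>. This weight, rather than a constant one, makes the a priori estimate
  strict even when \<open>\<bar>\<gamma>\<bar> = 1 / M\<close>: since \<open>q s \<le> s\<close>, the gain is at least the gap between \<open>1\<close>
  and \<open>1440 \<integral> G(1,s) s ds = 11/35\<close>. Hence the truncation is inactive for large \<open>R\<close>.
\<close>

section \<open>The Green function\<close>

lemma continuous_on_uncurried_compose:
  assumes "continuous_on UNIV (\<lambda>(x, y). h x y)" "continuous_on A a" "continuous_on A b"
  shows "continuous_on A (\<lambda>x. h (a x) (b x))"
  using continuous_on_compose2[OF assms(1) continuous_on_Pair[OF assms(2,3)]] by simp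

lemma continuous_on_integral_J:
  fixes h :: "'a::topological_space \<Rightarrow> real \<Rightarrow> real"
  assumes "continuous_on (UNIV \<times> J) (\<lambda>(x, s). h x s)"
  shows "continuous_on UNIV (\<lambda>x. integral J (h x))"
  using integral_continuous_on_param[of UNIV 0 1 h] assms by simp

text \<open>For kernels that vanish at all \<open>s\<close> beyond \<open>t\<close>: integrals over
  the fixed interval \<open>J\<close> become Volterra integrals over \<open>{0..t}\<close>.\<close>

lemma integral_J_eq_initial:
  fixes h :: "real \<Rightarrow> real"
  assumes "t \<in> J" "continuous_on J h" "\<And>s. t \<le> s \<Longrightarrow> h s = 0"
  shows "integral J h = integral {0..t} h"
proof -
  have "integral {0..t} h + integral {t..1} h = integral J h"
    using assms by (intro Henstock_Kurzweil_Integration.integral_combine) (auto intro: integrable_continuous_real)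
  moreover have "integral {t..1} h = integral {t..1} (\<lambda>_. 0)"
    using assms by (intro integral_cong) auto
  ultimately show ?thesis by simp
qed

text \<open>The Cauchy kernel of sixfold integration from \<open>0\<close>. The cutoff by
  \<open>max\<close> makes it jointly continuous and lets every integral run over
  \<open>J\<close>.\<close>

definition vker :: "real \<Rightarrow> real \<Rightarrow> real" where
  "vker t s = (max 0 (t - s))^5 / 120"

text \<open>The kernel that inverts minus the sixth derivative under vanishing derivatives of order
  0 to 4 at \<open>0\<close> and a vanishing second derivative at \<open>1\<close>. The coefficient
  of \<open>t^5\<close> is the only free one, and the condition at \<open>1\<close> determines
  it.\<close>

definition green :: "real \<Rightarrow> real \<Rightarrow> real" where
  "green t s = t^5 * ((1 - s)^3 / 120) - vker t s"

lemma green_1: "s \<in> J \<Longrightarrow> green 1 s = G1 s"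
  by (simp add: green_def vker_def G1_def fact_numeral field_simps)

lemma continuous_vker [continuous_intros]:
  "continuous_on A a \<Longrightarrow> continuous_on A b \<Longrightarrow> continuous_on A (\<lambda>x. vker (a x) (b x))"
  unfolding vker_def by (intro continuous_intros) auto

lemma continuous_green [continuous_intros]:
  "continuous_on A a \<Longrightarrow> continuous_on A b \<Longrightarrow> continuous_on A (\<lambda>x. green (a x) (b x))"
  unfolding green_def by (intro continuous_intros) auto

lemma continuous_green_integral:
  assumes "continuous_on J y"
  shows "continuous_on A (\<lambda>t. integral J (\<lambda>s. green t s * y s))"
proof -
  have "continuous_on (UNIV \<times> J) (\<lambda>(t, s). green t s * y s)"
    unfolding case_prod_unfold
    by (intro continuous_intros continuous_on_compose2[OF assms]) auto
  then show ?thesis by (rule continuous_on_subset[OF continuous_on_integral_J]) simp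
qed

section \<open>Pointwise bounds for the Green function\<close>

lemma vker_le:
  assumes "s \<in> J" "t \<in> J"
  shows "vker t s \<le> t^4 * (1 - s)^4 * max 0 (t - s) / 120"
proof -
  \<comment> \<open>This is applied to four of the five factors of \<open>vker\<close>. The fifth
    stays, to be bounded by \<open>t\<close> in the proof of positivity.\<close>
  have "max 0 (t - s) \<le> t * (1 - s)"
    using assms mult_left_le_one_le[of s t] mult_left_le_one_le[of t s]
    by (auto simp: algebra_simps max_def)
  then have "(max 0 (t - s))^4 \<le> (t * (1 - s))^4"
    by (intro power_mono) auto
  then have "(max 0 (t - s))^4 * max 0 (t - s) \<le> t^4 * (1 - s)^4 * max 0 (t - s)"
    unfolding power_mult_distrib by (intro mult_right_mono) auto
  then show ?thesis unfolding vker_def by (simp add: eval_nat_numeral mult_ac)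
qed

lemma green_nonneg:
  assumes "s \<in> J" "t \<in> J"
  shows "0 \<le> green t s"
proof -
  have "(1 - s)^4 * max 0 (t - s) \<le> (1 - s)^3 * t"
  proof (intro mult_mono)
    show "(1 - s)^4 \<le> (1 - s)^3" using assms by (intro power_decreasing) auto
  qed (use assms in auto)
  then have "t^4 * ((1 - s)^4 * max 0 (t - s)) \<le> t^4 * ((1 - s)^3 * t)"
    by (intro mult_left_mono) auto
  then show ?thesis
    using vker_le[OF assms] unfolding green_def by (simp add: eval_nat_numeral mult_ac)
qed

text \<open>From \<open>s\<close> onwards the Green function increases in \<open>t\<close>, since
  its derivative is nonnegative by \<open>z - s \<le> z * (1 - s)\<close>. Before \<open>s\<close>
  only the increasing \<open>t^5\<close> term is present, so the value at \<open>s\<close>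
  dominates.\<close>

lemma green_mono_1:
  assumes s: "s \<in> J" and t: "t \<in> J"
  shows "green t s \<le> green 1 s"
proof -
  let ?g = "\<lambda>t. t^5 * ((1 - s)^3 / 120) - (t - s)^5 / 120"
  have eq: "green x s = ?g x" if "s \<le> x" for x
    using that by (simp add: green_def vker_def)
  have mono: "?g x \<le> ?g y" if "s \<le> x" "x \<le> y" "y \<le> 1" for x y
  proof (rule DERIV_nonneg_imp_nondecreasing[OF that(2)])
    fix z assume z: "x \<le> z" "z \<le> y"
    have "z - s \<le> z * (1 - s)"
      using assms z that mult_left_le_one_le[of s z] by (auto simp: algebra_simps)
    then have "(z - s)^4 \<le> (z * (1 - s))^4"
      using z that by (intro power_mono) auto
    also have "\<dots> \<le> z^4 * (1 - s)^3"
      unfolding power_mult_distrib using s by (intro mult_left_mono power_decreasing) auto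
    finally have "0 \<le> (5 * z^4 * (1 - s)^3 - 5 * (z - s)^4) / 120" by simp
    moreover have "(?g has_real_derivative (5 * z^4 * (1 - s)^3 - 5 * (z - s)^4) / 120) (at z)"
      by (auto intro!: derivative_eq_intros simp: field_simps)
    ultimately show "\<exists>d. (?g has_real_derivative d) (at z) \<and> 0 \<le> d" by blast
  qed
  show ?thesis
  proof (cases "s \<le> t")
    case True
    then show ?thesis using mono[of t 1] eq s t by auto
  next
    case False
    have "green t s \<le> s^5 * ((1 - s)^3 / 120)"
      using False s t by (auto simp: green_def vker_def intro!: mult_right_mono power_mono)
    also have "\<dots> \<le> green 1 s"
      using mono[of s 1] eq[of 1] s by auto
    finally show ?thesis .
  qed
qed

lemma abs_green_le_1:
  assumes "s \<in> J" "t \<in> J"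
  shows "\<bar>green t s\<bar> \<le> 1"
proof -
  have "green 1 s \<le> (1 - s)^3 / 120"
    using assms by (simp add: green_def vker_def)
  also have "\<dots> \<le> 1" using assms power_le_one[of "1 - s" 3] by auto
  finally show ?thesis using green_nonneg[OF assms] green_mono_1[OF assms] by simp
qed

section \<open>Integrals of the Green function\<close>

lemma integral_vker:
  assumes "t \<in> J"
  shows "integral J (vker t) = t^6 / 720"
proof -
  have "integral J (vker t) = integral {0..t} (vker t)"
    by (rule integral_J_eq_initial[OF assms]) (auto intro!: continuous_intros simp: vker_def)
  also have "\<dots> = integral {0..t} (\<lambda>s. (t - s)^5 / 120)"
    by (intro integral_cong) (auto simp: vker_def)
  also have "((\<lambda>s. (t - s)^5 / 120) has_integral (- ((t - t)^6 / 720)) - (- ((t - 0)^6 / 720))) {0..t}"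
    using assms
    by (intro fundamental_theorem_of_calculus)
       (auto intro!: derivative_eq_intros simp flip: has_real_derivative_iff_has_vector_derivative)
  then have "integral {0..t} (\<lambda>s. (t - s)^5 / 120) = (- ((t - t)^6 / 720)) - (- ((t - 0)^6 / 720))"
    by (rule integral_unique)
  finally show ?thesis by simp
qed

text \<open>The integral of \<open>green t\<close> over \<open>J\<close>, scaled by 1440 so that its
  value at \<open>1\<close> is \<open>1\<close>. It serves as the weight of the truncation.\<close>

definition green_mass :: "real \<Rightarrow> real" where
  "green_mass t = 3 * t^5 - 2 * t^6"

text \<open>The upper bound rests on the factorisation of \<open>1 - t^2 * (3 - 2 * t)\<close> as
  \<open>(1 - t)^2 * (1 + 2 * t)\<close>. It later yields an affine majorant of the truncated
  right-hand side.\<close>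

lemma green_mass_bounds:
  assumes "t \<in> J"
  shows "0 \<le> green_mass t" "green_mass t \<le> t"
proof -
  have eq: "green_mass t = t * (t^4 * (3 - 2 * t))"
    by (simp add: green_mass_def eval_nat_numeral algebra_simps)
  show "0 \<le> green_mass t" unfolding eq using assms by auto
  have "t^4 * (3 - 2 * t) \<le> t^2 * (3 - 2 * t)"
    using assms by (intro mult_right_mono power_decreasing) auto
  also have "\<dots> = 1 - (1 - t)^2 * (1 + 2 * t)"
    by (simp add: power2_eq_square algebra_simps)
  also have "\<dots> \<le> 1" using assms by auto
  finally show "green_mass t \<le> t"
    unfolding eq using assms by (auto intro: mult_left_le)
qed

lemma integral_green:
  assumes "t \<in> J"
  shows "integral J (green t) = green_mass t / 1440"
proof -
  have 1: "((\<lambda>s. (1 - s)^3 / 120 :: real) has_integral (- ((1 - 1)^4 / 480)) - (- ((1 - 0)^4 / 480))) J"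
    by (intro fundamental_theorem_of_calculus)
       (auto intro!: derivative_eq_intros simp flip: has_real_derivative_iff_has_vector_derivative)
  have 2: "(vker t has_integral t^6 / 720) J"
    using integrable_integral[OF integrable_continuous_real[of 0 1 "vker t"]] integral_vker[OF assms]
    by (simp add: continuous_intros)
  show ?thesis
    using integral_unique[OF has_integral_diff[OF has_integral_mult_right[OF 1, of "t^5"] 2]]
    unfolding green_def[abs_def] green_mass_def by (simp add: field_simps)
qed

text \<open>Since \<open>green t s\<close> is at most \<open>green 1 s\<close>, a single explicit
  integral bounds all of them.\<close>

lemma integral_green_ident_le:
  assumes "t \<in> J"
  shows "integral J (\<lambda>s. green t s * s) \<le> 11 / 35 / 1440"
proof -
  \<comment> \<open>An antiderivative in powers of \<open>1 - s\<close>, obtained by writing the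
    factor \<open>s\<close> as \<open>1 - (1 - s)\<close>.\<close>
  let ?F = "\<lambda>s::real. - ((1 - s)^4 / 4 - (1 - s)^6 / 6 - (1 - s)^5 / 5 + (1 - s)^7 / 7) / 120"
  have "((\<lambda>s. ((1 - s)^3 - (1 - s)^5) / 120 * s) has_integral ?F 1 - ?F 0) J"
  proof (intro fundamental_theorem_of_calculus)
    fix s :: real assume "s \<in> J"
    have "(?F has_real_derivative ((1 - s)^3 - (1 - s)^5) / 120 * s) (at s within J)"
      by (auto intro!: derivative_eq_intros simp: eval_nat_numeral field_simps)
    then show "(?F has_vector_derivative ((1 - s)^3 - (1 - s)^5) / 120 * s) (at s within J)"
      by (simp add: has_real_derivative_iff_has_vector_derivative)
  qed simp
  then have 1: "((\<lambda>s. ((1 - s)^3 - (1 - s)^5) / 120 * s) has_integral 11 / 35 / 1440) J"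
    by simp
  have "integral J (\<lambda>s. green t s * s) \<le> integral J (\<lambda>s. ((1 - s)^3 - (1 - s)^5) / 120 * s)"
  proof (rule integral_le)
    fix s :: real assume s: "s \<in> J"
    have "green t s \<le> ((1 - s)^3 - (1 - s)^5) / 120"
      using green_mono_1[OF s assms] green_1[OF s] by (simp add: G1_def fact_numeral)
    then show "green t s * s \<le> ((1 - s)^3 - (1 - s)^5) / 120 * s"
      using s by (intro mult_right_mono) auto
  qed (use 1 in \<open>auto intro!: integrable_continuous_real continuous_intros\<close>)
  then show ?thesis using integral_unique[OF 1] by simp
qed

lemma integral_G1: "integral J G1 = 1 / 1440"
proof -
  have "integral J G1 = integral J (green 1)"
    by (intro integral_cong) (simp add: green_1)
  then show ?thesis by (simp add: integral_green green_mass_def)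
qed

text \<open>The two parts of the majorant are treated differently: the constant part gives the exact
  mass at \<open>t\<close>, the linear part a bound uniform in \<open>t\<close>. As 11/35 is less
  than 1, this improves on replacing \<open>s\<close> by \<open>1\<close>.\<close>

lemma green_potential_le:
  assumes y: "continuous_on J y" and le: "\<And>s. s \<in> J \<Longrightarrow> \<bar>y s\<bar> \<le> a + b * s" and "b \<ge> 0" and t: "t \<in> J"
  shows "\<bar>integral J (\<lambda>s. green t s * y s)\<bar> \<le> (a * green_mass t + b * (11 / 35)) / 1440"
proof -
  have "norm (integral J (\<lambda>s. green t s * y s)) \<le> integral J (\<lambda>s. a * green t s + b * (green t s * s))"
  proof (rule integral_norm_bound_integral)
    fix s :: real assume s: "s \<in> J"
    have "\<bar>green t s * y s\<bar> \<le> green t s * (a + b * s)"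
      unfolding abs_mult using green_nonneg[OF s t] le[OF s] by (intro mult_mono) auto
    then show "norm (green t s * y s) \<le> a * green t s + b * (green t s * s)"
      by (simp add: algebra_simps)
  qed (auto intro!: integrable_continuous_real continuous_intros y)
  also have "\<dots> = a * integral J (green t) + b * integral J (\<lambda>s. green t s * s)"
    by (subst integral_add) (auto intro!: integrable_continuous_real continuous_intros)
  also have "\<dots> \<le> a * (green_mass t / 1440) + b * (11 / 35 / 1440)"
    using mult_left_mono[OF integral_green_ident_le[OF t] \<open>b \<ge> 0\<close>] unfolding integral_green[OF t] by simp
  finally show ?thesis by (simp add: field_simps)
qed

section \<open>Regularity of Green potentials\<close>

lemma nderiv_Suc: "nderiv (Suc k) u t = vector_derivative (nderiv k u) (at t within J)"
  by (simp add: nderiv_def)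

text \<open>Computes the choice-based \<open>nderiv\<close> from an explicit chain \<open>D\<close>
  of derivatives. Derivatives within the nondegenerate interval \<open>J\<close> are unique, which
  carries the induction.\<close>

lemma nderiv_eq:
  assumes "\<And>t. t \<in> J \<Longrightarrow> u t = D 0 t"
    and D: "\<And>j t. j < k \<Longrightarrow> t \<in> J \<Longrightarrow> (D j has_real_derivative D (Suc j) t) (at t within J)"
    and "j \<le> k" "t \<in> J"
  shows "nderiv j u t = D j t"
  using assms(3,4)
proof (induction j arbitrary: t)
  case 0
  then show ?case using assms(1) by (simp add: nderiv_def)
next
  case (Suc j)
  have "(D j has_vector_derivative D (Suc j) t) (at t within J)"
    using D[of j t] Suc.prems by (simp add: has_real_derivative_iff_has_vector_derivative)
  then have "(nderiv j u has_vector_derivative D (Suc j) t) (at t within J)"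
    by (rule has_vector_derivative_transform[rotated 2]) (use Suc in auto)
  then show ?case
    unfolding nderiv_Suc using Suc.prems
    by (intro vector_derivative_within_closed_interval[of 0 1]) auto
qed

lemma C_kI:
  assumes u: "\<And>t. t \<in> J \<Longrightarrow> u t = D 0 t"
    and D: "\<And>j t. j < k \<Longrightarrow> t \<in> J \<Longrightarrow> (D j has_real_derivative D (Suc j) t) (at t within J)"
    and cont: "continuous_on J (D k)"
  shows "C_k k u"
  unfolding C_k_def
proof (intro conjI allI ballI impI)
  note eq = nderiv_eq[where D = D and k = k, OF u D]
  fix j t assume j: "j < k" and t: "t \<in> J"
  have "(nderiv j u has_real_derivative D (Suc j) t) (at t within J)"
    by (rule has_field_derivative_transform_within[OF D[OF j t] zero_less_one t]) (use eq j in auto)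
  then show "(nderiv j u has_real_derivative nderiv (Suc j) u t) (at t within J)"
    using eq[of "Suc j" t] j t by simp
next
  show "continuous_on J (nderiv k u)"
    using cont nderiv_eq[where D = D and k = k and j = k, OF u D] by (subst continuous_on_cong) auto
qed

section \<open>Iterated integrals from 0\<close>

primrec iter_integral :: "nat \<Rightarrow> (real \<Rightarrow> real) \<Rightarrow> real \<Rightarrow> real" where
  "iter_integral 0 y = y"
| "iter_integral (Suc k) y = (\<lambda>t. integral {0..t} (iter_integral k y))"

lemma continuous_iter_integral:
  "continuous_on J y \<Longrightarrow> continuous_on J (iter_integral k y)"
  by (induction k) (auto intro!: indefinite_integral_continuous_1 integrable_continuous_real)

lemma iter_integral_has_derivative:
  assumes "continuous_on J y" "t \<in> J"
  shows "(iter_integral (Suc k) y has_real_derivative iter_integral k y t) (at t within J)"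
  using integral_has_real_derivative[OF continuous_iter_integral[OF assms(1)] assms(2)] by simp

text \<open>Cauchy's formula for repeated integration. It is Taylor's formula with integral
  remainder, whose polynomial part disappears because iterated integrals vanish at
  \<open>0\<close>.\<close>

lemma iter_integral_eq:
  assumes y: "continuous_on J y" and t: "t \<in> J"
  shows "iter_integral (Suc k) y t = integral {0..t} (\<lambda>s. (t - s)^k / fact k * y s)"
proof -
  have "iter_integral (Suc k) y t
     = (\<Sum>i<Suc k. ((t - 0) ^ i / fact i) *\<^sub>R iter_integral (Suc k - i) y 0)
       + integral {0..t} (\<lambda>s. ((t - s)^(Suc k - 1) / fact (Suc k - 1)) *\<^sub>R iter_integral (Suc k - Suc k) y s)"
  proof (rule Taylor_integral)
    fix m s assume "m < Suc k" "0 \<le> s" "s \<le> t"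
    then show "(iter_integral (Suc k - m) y has_vector_derivative iter_integral (Suc k - Suc m) y s)
        (at s within {0..t})"
      using iter_integral_has_derivative[OF y, of s "k - m"] t
      by (auto simp: Suc_diff_le has_real_derivative_iff_has_vector_derivative simp del: iter_integral.simps
          intro: has_vector_derivative_within_subset)
  qed (use t in auto)
  also have "(\<Sum>i<Suc k. ((t - 0) ^ i / fact i) *\<^sub>R iter_integral (Suc k - i) y 0) = 0"
    by (intro sum.neutral) (auto simp: Suc_diff_le less_Suc_eq_le)
  finally show ?thesis by simp
qed

lemma green_potential_regularity:
  assumes y: "continuous_on J y"
    and u: "\<And>t. t \<in> J \<Longrightarrow> u t = A + integral J (\<lambda>s. green t s * y s)"
  shows "C_k 6 u" and "\<And>t. t \<in> J \<Longrightarrow> nderiv 6 u t = - y t"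
    and "\<And>j. j \<in> {1..4} \<Longrightarrow> nderiv j u 0 = 0" and "nderiv 2 u 1 = 0"
proof -
  define d where "d = integral J (\<lambda>s. (1 - s)^3 / 120 * y s)"
  \<comment> \<open>The chain of derivatives for \<open>nderiv_eq\<close>: on \<open>J\<close>,
    \<open>u\<close> is the polynomial A + d t^5 minus the sixfold integral of \<open>y\<close>, and
    each differentiation removes one integration.\<close>
  define D where "D j t = poly ((pderiv ^^ j) [:A, 0, 0, 0, 0, d:]) t - iter_integral (6 - j) y t" for j t
  have u_eq: "u t = D 0 t" if t: "t \<in> J" for t
  proof -
    have "integral J (\<lambda>s. vker t s * y s) = integral {0..t} (\<lambda>s. vker t s * y s)"
      by (rule integral_J_eq_initial[OF t]) (auto intro!: continuous_intros y simp: vker_def)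
    also have "\<dots> = integral {0..t} (\<lambda>s. (t - s)^5 / fact 5 * y s)"
      by (intro integral_cong) (auto simp: vker_def fact_numeral)
    also have "\<dots> = iter_integral 6 y t"
      using iter_integral_eq[OF y t, of 5] by (simp add: eval_nat_numeral del: fact_Suc)
    finally have "iter_integral 6 y t = integral J (\<lambda>s. vker t s * y s)" ..
    moreover have "integral J (\<lambda>s. green t s * y s)
        = integral J (\<lambda>s. t^5 * ((1 - s)^3 / 120 * y s) - vker t s * y s)"
      by (intro integral_cong) (simp add: green_def algebra_simps)
    then have "integral J (\<lambda>s. green t s * y s) = t^5 * d - integral J (\<lambda>s. vker t s * y s)"
      unfolding d_def
      by (subst (asm) integral_diff) (auto intro!: integrable_continuous_real continuous_intros y)
    ultimately show ?thesis
      using u[OF t] by (simp add: D_def eval_nat_numeral mult_ac del: iter_integral.simps)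
  qed
  have D: "(D j has_real_derivative D (Suc j) t) (at t within J)" if "j < 6" "t \<in> J" for j t
  proof -
    have "(iter_integral (6 - j) y has_real_derivative iter_integral (6 - Suc j) y t) (at t within J)"
      using iter_integral_has_derivative[OF y that(2), of "6 - Suc j"]
      Suc_diff_Suc[OF that(1)]
      by (simp only: Suc_diff_Suc)
    then show ?thesis
      unfolding D_def[abs_def] funpow.simps o_def
      by (intro DERIV_diff DERIV_subset[OF poly_DERIV]) auto
  qed
  have D6: "D 6 = (\<lambda>t. - y t)"
    by (simp add: D_def[abs_def] eval_nat_numeral pderiv_pCons)
  note eq = nderiv_eq[where D = D and k = 6, OF u_eq D]
  show "C_k 6 u"
    by (rule C_kI[of u D, OF u_eq D]) (auto simp: D6 intro!: continuous_intros y)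
  show "nderiv 6 u t = - y t" if "t \<in> J" for t
    using eq[of 6 t] that by (simp add: D6)
  show "nderiv j u 0 = 0" if "j \<in> {1..4}" for j
  proof -
    have "j \<in> {1, 2, 3, 4}" using that by auto
    moreover have "iter_integral (6 - j) y 0 = 0"
      using that by (cases "6 - j") auto
    ultimately show ?thesis
      using eq[of j 0] that by (auto simp: D_def eval_nat_numeral pderiv_pCons)
  qed
  \<comment> \<open>The second derivative of d t^5 at \<open>1\<close> is \<open>20 * d\<close>.
    Cauchy's formula shows that the fourfold integral of \<open>y\<close> cancels it, which explains
    the kernel of \<open>d\<close>.\<close>
  have "iter_integral 4 y 1 = integral J (\<lambda>s. (1 - s)^3 / fact 3 * y s)"
    using iter_integral_eq[OF y, of 1 3] by (simp del: iter_integral.simps fact_Suc)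
  also have "\<dots> = integral J (\<lambda>s. 20 * ((1 - s)^3 / 120 * y s))"
    by (intro integral_cong) (simp add: fact_numeral)
  also have "\<dots> = 20 * d"
    unfolding d_def by (rule integral_mult_right)
  finally have "iter_integral 4 y 1 = 20 * d" .
  then show "nderiv 2 u 1 = 0"
    using eq[of 2 1] by (simp add: D_def eval_nat_numeral pderiv_pCons del: iter_integral.simps)
qed

section \<open>Bounded right-hand sides\<close>

text \<open>Picard iterates of the delayed Cauchy problem. The pair \<open>z\<close> holds the value
  at \<open>0\<close> and the coefficient of \<open>t^5\<close>; before time \<open>0\<close> the
  unknown is continued by its initial value.\<close>

primrec delayed :: "(real \<Rightarrow> real \<Rightarrow> real) \<Rightarrow> real \<Rightarrow> nat \<Rightarrow> real \<times> real \<Rightarrow> real \<Rightarrow> real" where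
  "delayed F h 0 z t = fst z"
| "delayed F h (Suc k) z t = fst z + snd z * t^5
     - integral J (\<lambda>s. vker t s * F s (delayed F h k z (max 0 (s - h))))"

lemma continuous_delayed:
  assumes F: "continuous_on UNIV (\<lambda>(s, x). F s x)"
  shows "continuous_on UNIV (\<lambda>(z, t). delayed F h k z t)"
proof (induction k)
  case 0
  then show ?case by (simp add: case_prod_unfold) (intro continuous_intros)
next
  case (Suc k)
  have "continuous_on UNIV (\<lambda>x. integral J
          (\<lambda>s. vker (snd x) s * F s (delayed F h k (fst x) (max 0 (s - h)))))"
    by (intro continuous_on_integral_J, unfold case_prod_unfold)
       (intro continuous_intros continuous_on_uncurried_compose[OF F]
          continuous_on_uncurried_compose[OF Suc.IH])
  then show ?case by (auto simp: case_prod_unfold intro!: continuous_intros)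
qed

text \<open>The method of steps: since \<open>vker t s\<close> vanishes for \<open>s\<close> beyond
  \<open>t\<close>, the iterate at \<open>t\<close> depends on its predecessor only up to time
  \<open>max 0 (t - h)\<close>. Each iteration therefore gains a length \<open>h\<close>.\<close>

lemma delayed_stable:
  assumes "h > 0" "t \<in> J" "t \<le> real k * h"
  shows "delayed F h (Suc k) z t = delayed F h k z t"
  using assms(2,3)
proof (induction k arbitrary: t)
  case 0
  then have "t = 0" by simp
  have "integral J (\<lambda>s. vker 0 s * F s (fst z)) = integral J (\<lambda>s. 0)"
    by (intro integral_cong) (auto simp: vker_def)
  then show ?case using \<open>t = 0\<close> by simp
next
  case (Suc k)
  have "vker t s * F s (delayed F h (Suc k) z (max 0 (s - h)))
      = vker t s * F s (delayed F h k z (max 0 (s - h)))" if "s \<in> J" for s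
  proof (cases "s < t")
    case True
    then have "delayed F h (Suc k) z (max 0 (s - h)) = delayed F h k z (max 0 (s - h))"
      using Suc.prems that assms(1) by (intro Suc.IH) (auto simp: algebra_simps)
    then show ?thesis by (simp only:)
  next
    case False
    then show ?thesis by (simp add: vker_def)
  qed
  then show ?case
    by (subst delayed.simps(2), subst (2) delayed.simps(2)) (auto intro!: integral_cong)
qed

text \<open>Lipschitz continuity for the sup norm on \<open>J\<close>, stated with an arbitrary
  bound \<open>e\<close> so that no supremum has to be formed.\<close>

definition lipschitz_functional :: "real \<Rightarrow> ((real \<Rightarrow> real) \<Rightarrow> real) \<Rightarrow> bool" where
  "lipschitz_functional L B \<longleftrightarrow>
     (\<forall>v w e. continuous_on J v \<longrightarrow> continuous_on J w \<longrightarrow> (\<forall>t\<in>J. \<bar>v t - w t\<bar> \<le> e) \<longrightarrow>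
        \<bar>B v - B w\<bar> \<le> L * e)"

lemma lipschitz_functionalD:
  "lipschitz_functional L B \<Longrightarrow> continuous_on J v \<Longrightarrow> continuous_on J w \<Longrightarrow>
    (\<And>t. t \<in> J \<Longrightarrow> \<bar>v t - w t\<bar> \<le> e) \<Longrightarrow> \<bar>B v - B w\<bar> \<le> L * e"
  unfolding lipschitz_functional_def by blast

lemma lipschitz_functional_nonneg:
  assumes "lipschitz_functional L B"
  shows "0 \<le> L"
  using lipschitz_functionalD[OF assms, of "\<lambda>_. 0" "\<lambda>_. 0" 1] by simp

text \<open>Compactness of \<open>J\<close> turns joint continuity into uniform closeness of whole
  functions as the parameter varies.\<close>

lemma jointly_continuous_uniform_on_J:
  fixes V :: "'a::metric_space \<Rightarrow> real \<Rightarrow> real"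
  assumes V: "continuous_on UNIV (\<lambda>(z, t). V z t)" and "e > 0"
  obtains \<delta> where "\<delta> > 0" "\<And>y t. dist y z < \<delta> \<Longrightarrow> t \<in> J \<Longrightarrow> \<bar>V y t - V z t\<bar> \<le> e"
proof -
  obtain X where X: "z \<in> X" "open X" "\<And>y t. y \<in> X \<Longrightarrow> t \<in> J \<Longrightarrow> \<bar>V y t - V z t\<bar> \<le> e"
  proof (rule continuous_on_prod_compactE[OF _ compact_Icc UNIV_I[of z] \<open>e > 0\<close>])
    show "continuous_on (UNIV \<times> J) (\<lambda>(z, t). V z t)" by (rule continuous_on_subset[OF V]) simp
    fix X assume "z \<in> X" "open X"
      "\<forall>x\<in>X \<inter> UNIV. \<forall>t\<in>J. dist (case (x, t) of (z, t) \<Rightarrow> V z t) (case (z, t) of (z, t) \<Rightarrow> V z t) \<le> e"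
    then show thesis by (intro that[of X]) (simp_all add: dist_real_def)
  qed
  obtain \<delta> where "\<delta> > 0" "\<And>y. dist y z < \<delta> \<Longrightarrow> y \<in> X"
    using X(1,2) unfolding open_dist by blast
  then show thesis using X(3) that by blast
qed

text \<open>Supplies the continuity needed for Brouwer's theorem: uniform closeness on
  \<open>J\<close> is exactly what \<open>B\<close> respects.\<close>

lemma continuous_on_lipschitz_functional:
  fixes V :: "'a::metric_space \<Rightarrow> real \<Rightarrow> real"
  assumes B: "lipschitz_functional L B" and V: "continuous_on UNIV (\<lambda>(z, t). V z t)"
  shows "continuous_on UNIV (\<lambda>z. B (V z))"
  unfolding continuous_on_iff
proof (intro ballI allI impI)
  fix z :: 'a and e :: real assume "e > 0"
  define d where "d = e / (2 * (L + 1))"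
  have L: "0 \<le> L" using lipschitz_functional_nonneg[OF B] .
  have "d > 0" using L \<open>e > 0\<close> by (simp add: d_def)
  have contV: "continuous_on A (V y)" for y A
    by (intro continuous_on_uncurried_compose[OF V] continuous_intros)
  obtain \<delta> where \<delta>: "\<delta> > 0" "\<And>y t. dist y z < \<delta> \<Longrightarrow> t \<in> J \<Longrightarrow> \<bar>V y t - V z t\<bar> \<le> d"
    using jointly_continuous_uniform_on_J[OF V \<open>d > 0\<close>] by blast
  have "dist (B (V y)) (B (V z)) < e" if "dist y z < \<delta>" for y
  proof -
    have "\<bar>B (V y) - B (V z)\<bar> \<le> L * d"
      using \<delta>(2)[OF that] by (intro lipschitz_functionalD[OF B] contV)
    also have "\<dots> < e" using L \<open>e > 0\<close> by (simp add: d_def field_simps add_pos_nonneg add_nonneg_pos)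
    finally show ?thesis by (simp add: dist_real_def)
  qed
  with \<delta>(1) show "\<exists>\<delta>>0. \<forall>y\<in>UNIV. dist y z < \<delta> \<longrightarrow> dist (B (V y)) (B (V z)) < e" by blast
qed

section \<open>Existence for the delayed problem and passage to the limit\<close>

lemma abs_integral_J_le:
  fixes h :: "real \<Rightarrow> real"
  assumes "continuous_on J h" "\<And>s. s \<in> J \<Longrightarrow> \<bar>h s\<bar> \<le> C"
  shows "\<bar>integral J h\<bar> \<le> C"
  using integral_bound[OF _ assms(1)] assms(2) by simp

lemma abs_mult_le: "\<bar>a\<bar> \<le> 1 \<Longrightarrow> \<bar>b\<bar> \<le> C \<Longrightarrow> \<bar>a * b\<bar> \<le> C" for a b C :: real
  unfolding abs_mult using mult_mono[of "\<bar>a\<bar>" 1 "\<bar>b\<bar>" C] by simp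

lemma delayed_boundary_solution:
  assumes F: "continuous_on UNIV (\<lambda>(s, x). F s x)" and C: "\<And>s x. \<bar>F s x\<bar> \<le> C"
    and B: "lipschitz_functional L B" and h: "h > 0"
  obtains u where "continuous_on UNIV u"
    and "\<And>t. t \<in> J \<Longrightarrow> u t =
      B (\<lambda>t. integral J (\<lambda>s. green t s * F s (u (max 0 (s - h)))))
      + integral J (\<lambda>s. green t s * F s (u (max 0 (s - h))))"
proof -
  obtain k :: nat where k: "1 \<le> real k * h"
    using reals_Archimedean3[OF h] by (meson less_imp_le)
  \<comment> \<open>As \<open>k * h\<close> is at least \<open>1\<close>, this iterate is already
    stable on all of \<open>J\<close>, for every \<open>z\<close>.\<close>
  define U where "U = delayed F h k"
  have contU: "continuous_on UNIV (\<lambda>(z, t). U z t)"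
    unfolding U_def by (rule continuous_delayed[OF F])
  define H where "H z s = F s (U z (max 0 (s - h)))" for z s
  have contH: "continuous_on UNIV (\<lambda>(z, s). H z s)"
    unfolding H_def case_prod_unfold
    by (intro continuous_intros continuous_on_uncurried_compose[OF F]
          continuous_on_uncurried_compose[OF contU])
  note [continuous_intros] = continuous_on_uncurried_compose[OF contH]
  \<comment> \<open>The factor of \<open>t^5\<close> in \<open>green\<close>; hence
    \<open>D z\<close> below is the coefficient that the condition at \<open>1\<close>
    demands.\<close>
  define r :: "real \<Rightarrow> real" where "r s = (1 - s)^3 / 120" for s
  have contr [continuous_intros]: "continuous_on A a \<Longrightarrow> continuous_on A (\<lambda>x. r (a x))"
    for A :: "'b::topological_space set" and a
    unfolding r_def by (intro continuous_intros) auto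
  have r1: "\<bar>r s\<bar> \<le> 1" if "s \<in> J" for s
    using that power_le_one[of "1 - s" 3] by (auto simp: r_def)
  define V where "V z t = integral J (\<lambda>s. green t s * H z s)" for z t
  have contV: "continuous_on UNIV (\<lambda>(z, t). V z t)"
    unfolding V_def case_prod_unfold
    by (intro continuous_on_integral_J, unfold case_prod_unfold) (intro continuous_intros)
  define D where "D z = integral J (\<lambda>s. r s * H z s)" for z
  have contD: "continuous_on UNIV D"
    unfolding D_def
    by (intro continuous_on_integral_J, unfold case_prod_unfold)
       (intro continuous_intros)
  have H_le: "\<bar>H z s\<bar> \<le> C" for z s
    using C by (simp add: H_def)
  have D_le: "\<bar>D z\<bar> \<le> C" for z
    unfolding D_def by (intro abs_integral_J_le abs_mult_le r1 H_le) (auto intro!: continuous_intros)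
  have V_le: "\<bar>V z t\<bar> \<le> C" if "t \<in> J" for z t
    unfolding V_def using that
    by (intro abs_integral_J_le abs_mult_le abs_green_le_1 H_le) (auto intro!: continuous_intros)
  have contVz: "continuous_on A (V z)" for A z
    by (intro continuous_on_uncurried_compose[OF contV] continuous_intros)
  have BV_le: "\<bar>B (V z)\<bar> \<le> \<bar>B (\<lambda>_. 0)\<bar> + L * C" for z
    using lipschitz_functionalD[OF B contVz[of J z] continuous_on_const[of J 0], of C] V_le by auto
  define R where "R = \<bar>B (\<lambda>_. 0)\<bar> + L * C"
  have C0: "0 \<le> C" using C[of 0 0] by simp
  have R0: "0 \<le> R" using lipschitz_functional_nonneg[OF B] C0 by (simp add: R_def)
  let ?S = "{-R..R} \<times> {-C..C}"
  \<comment> \<open>At a fixed point the initial value and the coefficient of \<open>t^5\<close>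
    agree with the ones demanded by the boundary conditions. The box is invariant because the bounds
    on \<open>B (V z)\<close> and \<open>D z\<close> do not depend on \<open>z\<close>.\<close>
  obtain z where z: "z \<in> ?S" "(B (V z), D z) = z"
  proof (rule brouwer[of ?S "\<lambda>z. (B (V z), D z)"])
    show "compact ?S" by (intro compact_Times compact_Icc)
    show "convex ?S" by (intro convex_Times convex_real_interval)
    show "?S \<noteq> {}" using C0 R0 by auto
    show "continuous_on ?S (\<lambda>z. (B (V z), D z))"
      using continuous_on_lipschitz_functional[OF B contV] contD
      by (auto intro!: continuous_on_Pair intro: continuous_on_subset)
    show "(\<lambda>z. (B (V z), D z)) \<in> ?S \<rightarrow> ?S"
    proof -
      have "B (V z) \<in> {-R..R}" "D z \<in> {-C..C}" for z
        using BV_le[of z] D_le[of z] unfolding R_def by (auto simp: abs_le_iff)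
      then show ?thesis by auto
    qed
  qed
  have "U z t = B (V z) + V z t" if t: "t \<in> J" for t
  proof -
    \<comment> \<open>Passing to the next iterate exposes the integral equation, with
      \<open>U\<close> itself under the integral.\<close>
    have "U z t = delayed F h (Suc k) z t"
      unfolding U_def using t k by (intro delayed_stable[symmetric, OF h]) auto
    also have "\<dots> = B (V z) + (t^5 * D z - integral J (\<lambda>s. vker t s * H z s))"
      using z(2) by (simp add: H_def U_def) (metis fst_conv snd_conv mult.commute)
    also have "t^5 * D z - integral J (\<lambda>s. vker t s * H z s)
        = integral J (\<lambda>s. t^5 * (r s * H z s) - vker t s * H z s)"
      unfolding D_def
      by (subst integral_diff) (auto intro!: integrable_continuous_real continuous_intros)
    also have "\<dots> = V z t"
      unfolding V_def by (intro integral_cong) (simp add: green_def r_def algebra_simps)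
    finally show ?thesis .
  qed
  moreover have "continuous_on UNIV (U z)"
    by (intro continuous_on_uncurried_compose[OF contU] continuous_intros)
  ultimately show thesis
    using that[of "U z"] by (simp add: V_def[abs_def] H_def)
qed

lemma boundary_solution:
  assumes F: "continuous_on UNIV (\<lambda>(s, x). F s x)" and C: "\<And>s x. \<bar>F s x\<bar> \<le> C"
    and B: "lipschitz_functional L B"
  obtains u where "continuous_on J u"
    and "\<And>t. t \<in> J \<Longrightarrow> u t =
      B (\<lambda>t. integral J (\<lambda>s. green t s * F s (u s))) + integral J (\<lambda>s. green t s * F s (u s))"
proof -
  define h where "h n = inverse (real (Suc n))" for n
  have h0: "h n > 0" for n by (simp add: h_def)
  have "\<forall>n. \<exists>u. continuous_on UNIV u \<and> (\<forall>t\<in>J. u t =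
      B (\<lambda>t. integral J (\<lambda>s. green t s * F s (u (max 0 (s - h n)))))
      + integral J (\<lambda>s. green t s * F s (u (max 0 (s - h n)))))"
    by (intro allI) (rule delayed_boundary_solution[OF F C B h0], blast)
  then obtain u where contu: "\<And>n. continuous_on UNIV (u n)"
    and u: "\<And>n t. t \<in> J \<Longrightarrow> u n t =
      B (\<lambda>t. integral J (\<lambda>s. green t s * F s (u n (max 0 (s - h n)))))
      + integral J (\<lambda>s. green t s * F s (u n (max 0 (s - h n))))"
    unfolding choice_iff by blast
  define H where "H n s = F s (u n (max 0 (s - h n)))" for n s
  define W where "W n t = integral J (\<lambda>s. green t s * H n s)" for n t
  have uW: "u n t = B (W n) + W n t" if "t \<in> J" for n t
    using u[OF that] by (simp add: W_def[abs_def] H_def)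
  have contH [continuous_intros]: "continuous_on A (H n)" for n A
    unfolding H_def
    by (intro continuous_on_uncurried_compose[OF F] continuous_on_compose2[OF contu]
        continuous_intros) auto
  have contW: "continuous_on A (W n)" for n A
    unfolding W_def by (intro continuous_green_integral contH)
  have C0: "0 \<le> C" using C[of 0 0] by simp
  have L0: "0 \<le> L" using lipschitz_functional_nonneg[OF B] .
  have H_le: "\<bar>H n s\<bar> \<le> C" for n s
    using C by (simp add: H_def)
  have W_le: "\<bar>W n t\<bar> \<le> C" if "t \<in> J" for n t
    unfolding W_def using that
    by (intro abs_integral_J_le abs_mult_le abs_green_le_1 H_le) (auto intro!: continuous_intros)
  have BW_le: "\<bar>B (W n)\<bar> \<le> \<bar>B (\<lambda>_. 0)\<bar> + L * C" for n
    using lipschitz_functionalD[OF B contW[of J n] continuous_on_const[of J 0], of C] W_le by auto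
  define R where "R = \<bar>B (\<lambda>_. 0)\<bar> + L * C + C"
  have u_le: "\<bar>u n t\<bar> \<le> R" if "t \<in> J" for n t
    using uW[OF that, of n] W_le[OF that, of n] BW_le[of n] by (simp add: R_def)
  have contg: "continuous_on UNIV (\<lambda>(t, s). green t s)"
    unfolding case_prod_unfold by (intro continuous_intros)
  obtain w k where contw: "continuous_on J w" and k: "strict_mono (k :: nat \<Rightarrow> nat)"
    and lim: "\<And>e. 0 < e \<Longrightarrow> \<exists>N. \<forall>n x. n \<ge> N \<and> x \<in> J \<longrightarrow> norm (u (k n) x - w x) < e"
  proof (rule Arzela_Ascoli[OF compact_Icc, of 0 1 u R])
    show "norm (u n x) \<le> R" if "x \<in> J" for n x
      using u_le[OF that] by simp
    fix x e :: real assume x: "x \<in> J" and "0 < e"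
    define e' where "e' = e / (C + 1)"
    have e': "e' > 0" "e' * C < e" using C0 \<open>0 < e\<close> by (auto simp: e'_def field_simps)
    obtain \<delta> where \<delta>: "\<delta> > 0"
        "\<And>y t. dist y x < \<delta> \<Longrightarrow> t \<in> J \<Longrightarrow> \<bar>green y t - green x t\<bar> \<le> e'"
      using jointly_continuous_uniform_on_J[OF contg e'(1)] by blast
    have "norm (u n x - u n y) < e" if y: "y \<in> J" "norm (x - y) < \<delta>" for n y
    proof -
      \<comment> \<open>Equicontinuity: the constant \<open>B (W n)\<close> cancels, and what
        remains is controlled by the modulus of continuity of \<open>green\<close> and the bound
        \<open>C\<close>, both independent of \<open>n\<close>.\<close>
      have "u n y - u n x = integral J (\<lambda>s. green y s * H n s - green x s * H n s)"
        unfolding uW[OF x] uW[OF y(1)] W_def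
        by (subst integral_diff) (auto intro!: integrable_continuous_real continuous_intros)
      also have "\<bar>\<dots>\<bar> \<le> e' * C"
      proof (rule abs_integral_J_le)
        fix s :: real assume "s \<in> J"
        then have "\<bar>green y s - green x s\<bar> \<le> e'"
          using \<delta>(2)[of y s] y(2) by (simp add: dist_norm norm_minus_commute)
        then have "\<bar>(green y s - green x s) * H n s\<bar> \<le> e' * C"
          unfolding abs_mult using H_le e'(1) by (intro mult_mono) auto
        then show "\<bar>green y s * H n s - green x s * H n s\<bar> \<le> e' * C"
          by (simp add: left_diff_distrib)
      qed (intro continuous_intros)
      finally show ?thesis using e'(2) by (simp add: abs_minus_commute)
    qed
    with \<delta>(1) show "\<exists>d>0. \<forall>n y. y \<in> J \<and> norm (x - y) < d \<longrightarrow> norm (u n x - u n y) < e"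
      by blast
  next
    fix w k assume "continuous_on J w" "strict_mono (k :: nat \<Rightarrow> nat)"
      "\<And>e. 0 < e \<Longrightarrow> \<exists>N. \<forall>n x. n \<ge> N \<and> x \<in> J \<longrightarrow> norm (u (k n) x - w x) < e"
    then show thesis by (rule that)
  qed
  have contFw: "continuous_on J (\<lambda>s. F s (w s))"
    by (intro continuous_on_uncurried_compose[OF F] contw continuous_intros)
  define V where "V t = integral J (\<lambda>s. green t s * F s (w s))" for t
  have contV: "continuous_on A V" for A
    unfolding V_def by (intro continuous_green_integral contFw)
  have close: "\<exists>N. \<forall>n\<ge>N. \<forall>s\<in>J. \<bar>H (k n) s - F s (w s)\<bar> \<le> e" if "e > 0" for e
  proof -
    \<comment> \<open>The extra 1 makes room for \<open>w\<close>, which lies within distance 1 of a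
      function bounded by \<open>R\<close>.\<close>
    let ?Q = "J \<times> {-(R + 1)..R + 1}"
    have "uniformly_continuous_on ?Q (\<lambda>(s, x). F s x)"
      by (intro compact_uniformly_continuous compact_Times compact_Icc continuous_on_subset[OF F]) simp
    then obtain \<delta> where \<delta>: "\<delta> > 0"
      "\<And>a b. a \<in> ?Q \<Longrightarrow> b \<in> ?Q \<Longrightarrow> dist a b < \<delta> \<Longrightarrow>
        dist (case a of (s, x) \<Rightarrow> F s x) (case b of (s, x) \<Rightarrow> F s x) < e"
      using \<open>e > 0\<close> unfolding uniformly_continuous_on_def by metis
    \<comment> \<open>The delay is absorbed by the limit: \<open>u (k n)\<close> is compared with
      \<open>w\<close> at the delayed time, then \<open>w\<close> at the delayed time with
      \<open>w\<close> at \<open>s\<close>.\<close>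
    have "uniformly_continuous_on J w"
      by (intro compact_uniformly_continuous contw compact_Icc)
    then obtain \<rho> where \<rho>: "\<rho> > 0" "\<And>a b. a \<in> J \<Longrightarrow> b \<in> J \<Longrightarrow> dist a b < \<rho> \<Longrightarrow> dist (w a) (w b) < \<delta> / 2"
      using \<delta>(1) unfolding uniformly_continuous_on_def by (metis half_gt_zero)
    obtain N where N: "\<And>n x. n \<ge> N \<Longrightarrow> x \<in> J \<Longrightarrow> norm (u (k n) x - w x) < min 1 (\<delta> / 2)"
      using lim[of "min 1 (\<delta> / 2)"] \<delta>(1) by auto
    obtain N' where N': "h N' < \<rho>"
      using reals_Archimedean[OF \<rho>(1)] unfolding h_def by blast
    have "\<bar>H (k n) s - F s (w s)\<bar> \<le> e" if n: "n \<ge> max N N'" and s: "s \<in> J" for n s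
    proof -
      define s' where "s' = max 0 (s - h (k n))"
      have "h (k n) \<le> h N'"
        using n seq_suble[OF k, of n] unfolding h_def by (intro le_imp_inverse_le) auto
      then have s': "s' \<in> J" "dist s' s < \<rho>"
        using s N' h0[of "k n"] by (auto simp: s'_def dist_real_def)
      have 1: "\<bar>u (k n) s' - w s'\<bar> < \<delta> / 2" "\<bar>u (k n) s - w s\<bar> < 1"
        using N[of n s'] N[of n s] n s s'(1) by auto
      have 2: "\<bar>w s' - w s\<bar> < \<delta> / 2"
        using \<rho>(2)[OF s'(1) s s'(2)] by (simp add: dist_real_def)
      have "\<bar>u (k n) s' - w s\<bar> < \<delta>"
        using 1(1) 2 by linarith
      then have "dist (s, u (k n) s') (s, w s) < \<delta>"
        by (simp add: dist_Pair_Pair dist_real_def)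
      moreover have "(s, u (k n) s') \<in> ?Q" "(s, w s) \<in> ?Q"
        using u_le[OF s'(1), of "k n"] u_le[OF s, of "k n"] 1 s by auto
      ultimately show ?thesis
        using \<delta>(2) by (fastforce simp: H_def s'_def dist_real_def)
    qed
    then show ?thesis by blast
  qed
  have "w t = B V + V t" if t: "t \<in> J" for t
  proof -
    have "\<bar>w t - (B V + V t)\<bar> \<le> 0 + e" if "e > 0" for e
    proof -
      \<comment> \<open>The share of each error: \<open>L\<close> shares for the functional
        \<open>B\<close>, one for the potential and one for the distance of \<open>u (k n)\<close>
        from \<open>w\<close>.\<close>
      define e' where "e' = e / (L + 2)"
      have e': "e' > 0" "(L + 2) * e' = e" using L0 \<open>e > 0\<close> by (auto simp: e'_def)
      obtain N where N: "\<And>n s. n \<ge> N \<Longrightarrow> s \<in> J \<Longrightarrow> \<bar>H (k n) s - F s (w s)\<bar> \<le> e'"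
        using close[OF e'(1)] by blast
      obtain N' where N': "\<And>n x. n \<ge> N' \<Longrightarrow> x \<in> J \<Longrightarrow> norm (u (k n) x - w x) < e'"
        using lim[OF e'(1)] by blast
      define n where "n = max N N'"
      have WV: "\<bar>W (k n) t - V t\<bar> \<le> e'" if "t \<in> J" for t
      proof -
        have "W (k n) t - V t = integral J (\<lambda>s. green t s * H (k n) s - green t s * F s (w s))"
          unfolding W_def V_def
          by (subst integral_diff)
             (auto intro!: integrable_continuous_real continuous_intros contFw)
        also have "\<bar>\<dots>\<bar> \<le> e'"
        proof (rule abs_integral_J_le)
          fix s :: real assume "s \<in> J"
          then have "\<bar>green t s * (H (k n) s - F s (w s))\<bar> \<le> e'"
            using that N[of n s] by (intro abs_mult_le abs_green_le_1) (auto simp: n_def)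
          then show "\<bar>green t s * H (k n) s - green t s * F s (w s)\<bar> \<le> e'"
            by (simp add: right_diff_distrib)
        qed (intro continuous_intros contFw)
        finally show ?thesis .
      qed
      have "\<bar>B (W (k n)) - B V\<bar> \<le> L * e'"
        by (intro lipschitz_functionalD[OF B] contW contV WV)
      moreover have "\<bar>u (k n) t - w t\<bar> < e'"
        using N'[of n t] t by (simp add: n_def)
      ultimately show ?thesis
        using uW[OF t, of "k n"] WV[OF t] e'(2) by (simp add: algebra_simps)
    qed
    then show ?thesis using field_le_epsilon[of "\<bar>w t - (B V + V t)\<bar>" 0] by simp
  qed
  then show thesis
    using that[OF contw] by (simp add: V_def[abs_def])
qed

section \<open>The nonlocal boundary condition\<close>

definition nonlocal_functional ::
  "nat \<Rightarrow> (nat \<Rightarrow> real) \<Rightarrow> (nat \<Rightarrow> real) \<Rightarrow> (nat \<Rightarrow> real) \<Rightarrow> (real \<Rightarrow> real) \<Rightarrow> real" where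
  "nonlocal_functional m \<eta> \<alpha> \<beta> v =
     (\<Sum>i=1..m-1. \<alpha> i * integral {\<eta> i..\<eta> (i+1)} v) + (\<Sum>i=1..m. \<beta> i * v (\<eta> i))"

text \<open>A bound for the operator norm of \<open>nonlocal_functional\<close>; divided by the
  modulus of \<open>bvp_mu\<close> it is the sum appearing in \<open>bvp_M\<close>.\<close>

definition nonlocal_bound ::
  "nat \<Rightarrow> (nat \<Rightarrow> real) \<Rightarrow> (nat \<Rightarrow> real) \<Rightarrow> (nat \<Rightarrow> real) \<Rightarrow> real" where
  "nonlocal_bound m \<eta> \<alpha> \<beta> =
     (\<Sum>i=1..m-1. \<bar>\<alpha> i\<bar> * (\<eta> (i+1) - \<eta> i)) + (\<Sum>i=1..m. \<bar>\<beta> i\<bar>)"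

context
  fixes m :: nat and \<eta> \<alpha> \<beta> :: "nat \<Rightarrow> real"
  assumes \<eta>1: "0 < \<eta> 1" and \<eta>_less: "\<forall>i\<in>{1..<m}. \<eta> i < \<eta> (i+1)" and \<eta>m: "\<eta> m \<le> 1"
begin

lemma nodes_in_J:
  assumes "i \<in> {1..m}"
  shows "\<eta> i \<in> J"
proof -
  have mono: "\<eta> i \<le> \<eta> j" if "1 \<le> i" "i \<le> j" "j \<le> m" for i j
    using that(2,3)
  proof (induction j rule: dec_induct)
    case (step n)
    then have "\<eta> n < \<eta> (n + 1)" using \<eta>_less that(1) by auto
    then show ?case using step by simp
  qed simp
  show ?thesis using mono[of 1 i] mono[of i m] assms \<eta>1 \<eta>m by auto
qed

lemma node_intervals:
  assumes "i \<in> {1..m-1}"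
  shows "\<eta> i \<le> \<eta> (i+1)" "{\<eta> i..\<eta> (i+1)} \<subseteq> J"
  using assms nodes_in_J[of i] nodes_in_J[of "i+1"] \<eta>_less by (auto simp: less_imp_le)

lemma nonlocal_functional_diff:
  assumes "continuous_on J v" "continuous_on J w"
  shows "nonlocal_functional m \<eta> \<alpha> \<beta> (\<lambda>t. v t - w t)
       = nonlocal_functional m \<eta> \<alpha> \<beta> v - nonlocal_functional m \<eta> \<alpha> \<beta> w"
proof -
  have "integral {\<eta> i..\<eta> (i+1)} (\<lambda>t. v t - w t) = integral {\<eta> i..\<eta> (i+1)} v - integral {\<eta> i..\<eta> (i+1)} w"
    if "i \<in> {1..m-1}" for i
    using node_intervals(2)[OF that] assms
    by (intro integral_diff integrable_continuous_real) (auto intro: continuous_on_subset)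
  then show ?thesis
    unfolding nonlocal_functional_def
    by (simp add: right_diff_distrib sum_subtractf)
qed

lemma abs_nonlocal_functional_le:
  assumes v: "continuous_on J v" and e: "\<And>t. t \<in> J \<Longrightarrow> \<bar>v t\<bar> \<le> e"
  shows "\<bar>nonlocal_functional m \<eta> \<alpha> \<beta> v\<bar> \<le> nonlocal_bound m \<eta> \<alpha> \<beta> * e"
proof -
  have "\<bar>\<alpha> i * integral {\<eta> i..\<eta> (i+1)} v\<bar> \<le> \<bar>\<alpha> i\<bar> * (\<eta> (i+1) - \<eta> i) * e" if i: "i \<in> {1..m-1}" for i
  proof -
    have "norm (integral {\<eta> i..\<eta> (i+1)} v) \<le> e * (\<eta> (i+1) - \<eta> i)"
      using node_intervals[OF i] e
      by (intro integral_bound continuous_on_subset[OF v]) auto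
    from mult_left_mono[OF this, of "\<bar>\<alpha> i\<bar>"] show ?thesis by (simp add: abs_mult mult_ac)
  qed
  moreover have "\<bar>\<beta> i * v (\<eta> i)\<bar> \<le> \<bar>\<beta> i\<bar> * e" if "i \<in> {1..m}" for i
    using e[OF nodes_in_J[OF that]] by (simp add: abs_mult mult_left_mono)
  ultimately show ?thesis
    unfolding nonlocal_functional_def nonlocal_bound_def distrib_right sum_distrib_right
    by (intro order.trans[OF abs_triangle_ineq] add_mono order.trans[OF sum_abs] sum_mono)
qed

text \<open>The role of \<open>bvp_mu\<close>: it is the defect of the boundary condition on the
  constant function 1.\<close>

lemma nonlocal_functional_const:
  "nonlocal_functional m \<eta> \<alpha> \<beta> (\<lambda>_. A) = A * (1 - bvp_mu m \<eta> \<alpha> \<beta>)"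
proof -
  have "(\<Sum>i=1..m-1. \<alpha> i * integral {\<eta> i..\<eta> (i+1)} (\<lambda>_. A))
      = (\<Sum>i=1..m-1. A * (\<alpha> i * (\<eta> (i+1) - \<eta> i)))"
    using node_intervals(1) by (intro sum.cong) auto
  then show ?thesis
    unfolding nonlocal_functional_def bvp_mu_def
    by (simp add: distrib_left sum_distrib_left mult.commute)
qed

lemma nonlocal_functional_cong:
  assumes "\<And>t. t \<in> J \<Longrightarrow> v t = w t"
  shows "nonlocal_functional m \<eta> \<alpha> \<beta> v = nonlocal_functional m \<eta> \<alpha> \<beta> w"
  unfolding nonlocal_functional_def
proof (intro arg_cong2[where f = "(+)"] sum.cong refl)
  fix i assume "i \<in> {1..m-1}"
  then show "\<alpha> i * integral {\<eta> i..\<eta> (i+1)} v = \<alpha> i * integral {\<eta> i..\<eta> (i+1)} w"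
    using node_intervals(2)[of i] assms by (auto intro!: integral_cong)
qed (use assms nodes_in_J in auto)

text \<open>With A the quotient of the functional at \<open>v\<close> by \<open>bvp_mu\<close>, the
  functional takes at A + v the value A (1 - \<mu>) + A \<mu> = A. This is also the value of
  \<open>u\<close> at \<open>0\<close>, where the Green function vanishes.\<close>

lemma bvp_solution_from_potential:
  assumes \<mu>: "bvp_mu m \<eta> \<alpha> \<beta> \<noteq> 0" and y: "continuous_on J y"
    and v_def: "v = (\<lambda>t. integral J (\<lambda>s. green t s * y s))"
    and u: "\<And>t. t \<in> J \<Longrightarrow> u t = nonlocal_functional m \<eta> \<alpha> \<beta> v / bvp_mu m \<eta> \<alpha> \<beta> + v t"
    and f: "\<And>t. t \<in> J \<Longrightarrow> y t = f t (u t)"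
  shows "bvp_solution m \<eta> \<alpha> \<beta> f u"
proof -
  let ?N = "nonlocal_functional m \<eta> \<alpha> \<beta>"
  define A where "A = ?N v / bvp_mu m \<eta> \<alpha> \<beta>"
  have contv: "continuous_on J v"
    unfolding v_def by (rule continuous_green_integral[OF y])
  have uA: "u t = A + integral J (\<lambda>s. green t s * y s)" if "t \<in> J" for t
    using u[OF that] by (simp add: A_def v_def)
  note reg = green_potential_regularity[OF y uA]
  \<comment> \<open>The constant is expressed as the difference \<open>v - u\<close>, so that
    \<open>nonlocal_functional_diff\<close> applies.\<close>
  have "?N (\<lambda>t. v t - u t) = ?N (\<lambda>_. - A)"
    using uA by (intro nonlocal_functional_cong) (simp add: v_def)
  moreover have contu: "continuous_on J u"
  proof -
    have "continuous_on J (\<lambda>t. A + v t)" by (intro continuous_intros contv)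
    then show ?thesis using uA by (subst continuous_on_cong) (auto simp: v_def)
  qed
  ultimately have "?N u = ?N v + A * (1 - bvp_mu m \<eta> \<alpha> \<beta>)"
    using nonlocal_functional_diff[OF contv contu] nonlocal_functional_const[of "- A"] by simp
  also have "?N v = A * bvp_mu m \<eta> \<alpha> \<beta>"
    using \<mu> by (simp add: A_def)
  finally have "?N u = A" by (simp add: algebra_simps)
  moreover have "u 0 = A"
  proof -
    have "integral J (\<lambda>s. green 0 s * y s) = integral J (\<lambda>s. 0)"
      by (intro integral_cong) (auto simp: green_def vker_def)
    then show ?thesis using uA[of 0] by simp
  qed
  ultimately show ?thesis
    using reg f unfolding bvp_solution_def nonlocal_functional_def by auto
qed

end

section \<open>Asymptotically linear right-hand sides\<close>

text \<open>Far out the limit controls the quotient; on the remaining compact interval continuity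
  bounds \<open>g\<close> by a constant.\<close>

lemma sublinear_bound:
  fixes g :: "real \<Rightarrow> real"
  assumes g: "continuous_on UNIV g" and lim: "((\<lambda>x. g x / x) \<longlongrightarrow> \<gamma>) at_infinity" and "\<epsilon> > 0"
  obtains C where "C \<ge> 0" "\<And>x. \<bar>g x\<bar> \<le> (\<bar>\<gamma>\<bar> + \<epsilon>) * \<bar>x\<bar> + C"
proof -
  have "\<forall>\<^sub>F x in at_infinity. dist (g x / x) \<gamma> < \<epsilon>"
    using lim \<open>\<epsilon> > 0\<close> by (rule tendstoD)
  then obtain b where b: "\<And>x. b \<le> norm x \<Longrightarrow> dist (g x / x) \<gamma> < \<epsilon>"
    unfolding eventually_at_infinity by blast
  \<comment> \<open>The radius is at least 1, so that outside the ball the division by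
    \<open>x\<close> is legitimate.\<close>
  have "bounded (g ` cball 0 (max b 1))"
    by (intro compact_imp_bounded compact_continuous_image continuous_on_subset[OF g]) auto
  then obtain C where C: "C > 0" "\<And>x. \<bar>x\<bar> \<le> max b 1 \<Longrightarrow> \<bar>g x\<bar> \<le> C"
    unfolding bounded_pos by (auto simp: cball_def dist_real_def)
  have "\<bar>g x\<bar> \<le> (\<bar>\<gamma>\<bar> + \<epsilon>) * \<bar>x\<bar> + C" for x
  proof (cases "\<bar>x\<bar> \<le> max b 1")
    case True
    have "0 \<le> (\<bar>\<gamma>\<bar> + \<epsilon>) * \<bar>x\<bar>" using \<open>\<epsilon> > 0\<close> by simp
    then show ?thesis using C(2)[OF True] by linarith
  next
    case False
    then have "b \<le> norm x" by simp
    then have "\<bar>g x / x\<bar> \<le> \<bar>\<gamma>\<bar> + \<epsilon>"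
      using b[of x] unfolding dist_real_def by linarith
    then show ?thesis
      using False C(1) by (simp add: abs_divide field_simps)
  qed
  then show thesis using that[of C] C(1) by simp
qed

theorem theorem3p2:
  fixes m :: nat and \<eta> \<alpha> \<beta> :: "nat \<Rightarrow> real"
    and f :: "real \<Rightarrow> real \<Rightarrow> real" and p g :: "real \<Rightarrow> real" and \<gamma> t\<^sub>0 :: real
  assumes "m \<ge> 2"
    and "0 < \<eta> 1" and "\<forall>i\<in>{1..<m}. \<eta> i < \<eta> (i+1)" and "\<eta> m \<le> 1"
    and "bvp_mu m \<eta> \<alpha> \<beta> \<noteq> 0"
    and "\<forall>t\<in>J. \<forall>x. f t x = p t * g x"
    and "continuous_on J p" and "continuous_on UNIV g"
    and "((\<lambda>x. g x / x) \<longlongrightarrow> \<gamma>) at_infinity"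
    and "t\<^sub>0 \<in> {0<..1}" and "f t\<^sub>0 0 \<noteq> 0"
    and "\<bar>\<gamma>\<bar> \<le> 1 / bvp_M m \<eta> \<alpha> \<beta> p"
  shows "\<exists>u. continuous_on J u \<and> bvp_solution m \<eta> \<alpha> \<beta> f u \<and> nontrivial u"
proof -
  note f = assms(6) and p = assms(7) and g = assms(8)
  define \<mu> where "\<mu> = bvp_mu m \<eta> \<alpha> \<beta>"
  define B where "B v = nonlocal_functional m \<eta> \<alpha> \<beta> v / \<mu>" for v
  define L where "L = nonlocal_bound m \<eta> \<alpha> \<beta> / \<bar>\<mu>\<bar>"
  have B_le: "\<bar>B v\<bar> \<le> L * e" if "continuous_on J v" "\<And>t. t \<in> J \<Longrightarrow> \<bar>v t\<bar> \<le> e" for v e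
    using abs_nonlocal_functional_le[OF assms(2-4) that] assms(5)
    by (simp add: B_def L_def \<mu>_def abs_divide divide_right_mono)
  have B: "lipschitz_functional L B"
    unfolding lipschitz_functional_def
  proof (intro allI impI)
    fix v w :: "real \<Rightarrow> real" and e :: real
    assume vw: "continuous_on J v" "continuous_on J w" "\<forall>t\<in>J. \<bar>v t - w t\<bar> \<le> e"
    have "B v - B w = B (\<lambda>t. v t - w t)"
      using nonlocal_functional_diff[OF assms(2-4) vw(1,2)] by (simp add: B_def diff_divide_distrib)
    then show "\<bar>B v - B w\<bar> \<le> L * e"
      using B_le[of "\<lambda>t. v t - w t" e] vw by (simp add: continuous_on_diff)
  qed
  have L0: "0 \<le> L" using lipschitz_functional_nonneg[OF B] .
  define P where "P = p_star p"
  have p_le: "\<bar>p t\<bar> \<le> P" if "t \<in> J" for t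
    unfolding P_def p_star_def
    by (intro cSUP_upper that bounded_imp_bdd_above compact_imp_bounded compact_continuous_image
        continuous_intros p compact_Icc)
  have pg0: "p t\<^sub>0 * g 0 \<noteq> 0" and t0: "t\<^sub>0 \<in> J"
    using assms(10,11) f by auto
  \<comment> \<open>Nontriviality of the data makes \<open>M\<close> positive, so
    \<open>1 / M\<close> is a genuine quotient and not the default value of a division by
    zero.\<close>
  have P: "P > 0" using pg0 p_le[OF t0] by auto
  define M where "M = P * (1 + L) / 1440"
  have M: "M > 0" using P L0 by (simp add: M_def)
  have "bvp_M m \<eta> \<alpha> \<beta> p = M"
    by (simp add: bvp_M_def M_def L_def nonlocal_bound_def integral_G1 P_def \<mu>_def add_divide_distrib add.assoc)
  then have \<gamma>: "M * \<bar>\<gamma>\<bar> \<le> 1" using assms(12) M by (simp add: field_simps)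
  \<comment> \<open>\<open>N\<close> dominates \<open>green_mass t + L + 11 / 35\<close> for every
    \<open>t\<close> in \<open>J\<close>.\<close>
  define N where "N = 2 + L"
  have "N > 0" using L0 by (simp add: N_def)
  \<comment> \<open>The gap 1 - 11/35 = 24/35 is spent in two halves: 12/35 on the error
    \<open>\<epsilon>\<close> in the slope of \<open>g\<close>, and 12/35 on the additive constant
    \<open>C\<close>.\<close>
  define \<epsilon> where "\<epsilon> = 12 / 35 / (M * N)"
  have \<epsilon>: "\<epsilon> > 0" "M * \<epsilon> * N = 12 / 35" using M \<open>N > 0\<close> by (auto simp: \<epsilon>_def)
  obtain C where C: "C \<ge> 0" "\<And>x. \<bar>g x\<bar> \<le> (\<bar>\<gamma>\<bar> + \<epsilon>) * \<bar>x\<bar> + C"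
    using sublinear_bound[OF g assms(9) \<epsilon>(1)] by blast
  \<comment> \<open>Chosen so that \<open>M * C\<close> is at most \<open>12 / 35 * R\<close>; the
    summand 1 makes \<open>R\<close> positive even if \<open>C\<close> is \<open>0\<close>.\<close>
  define R where "R = 35 / 12 * (M * C) + 1"
  have R: "R > 0" using M C(1) by (simp add: R_def add_nonneg_pos)
  \<comment> \<open>The retraction of the real line onto \<open>J\<close>. It extends the data
    continuously, as \<open>boundary_solution\<close> requires a right-hand side on the whole
    plane.\<close>
  define c :: "real \<Rightarrow> real" where "c s = max 0 (min 1 s)" for s
  have c: "c s \<in> J" for s by (simp add: c_def)
  have c_id: "c s = s" if "s \<in> J" for s using that by (simp add: c_def)
  have contc: "continuous_on A c" for A unfolding c_def by (intro continuous_intros)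
  define K where "K s = R * (1 + L + green_mass (c s))" for s
  have contK: "continuous_on A K" for A
    unfolding K_def green_mass_def by (intro continuous_intros contc)
  have K0: "0 \<le> K s" for s
    using R L0 green_mass_bounds(1)[OF c, of s] by (simp add: K_def)
  define T where "T s x = max (- K s) (min (K s) x)" for s x
  have T_le: "\<bar>T s x\<bar> \<le> K s" for s x using K0[of s] by (auto simp: T_def)
  define F where "F s x = p (c s) * g (T s x)" for s x
  have contF: "continuous_on UNIV (\<lambda>(s, x). F s x)"
    unfolding F_def T_def case_prod_unfold
    by (intro continuous_intros continuous_on_compose2[OF p] continuous_on_compose2[OF g]
          continuous_on_compose2[OF contc] continuous_on_compose2[OF contK]) (use c in auto)
  define a where "a = (\<bar>\<gamma>\<bar> + \<epsilon>) * R"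
  have a: "a > 0" using \<epsilon>(1) R by (simp add: a_def add_nonneg_pos)
  \<comment> \<open>The estimate \<open>green_mass (c s) \<le> c s\<close> makes the majorant affine
    in \<open>s\<close>, in the form needed for \<open>green_potential_le\<close>.\<close>
  have F_le: "\<bar>F s x\<bar> \<le> P * (a * (1 + L) + C) + P * a * c s" for s x
  proof -
    have "\<bar>g (T s x)\<bar> \<le> (\<bar>\<gamma>\<bar> + \<epsilon>) * K s + C"
      using C(2)[of "T s x"] mult_left_mono[OF T_le, of "\<bar>\<gamma>\<bar> + \<epsilon>" s x] \<epsilon>(1) by simp
    also have "(\<bar>\<gamma>\<bar> + \<epsilon>) * K s = a * (1 + L + green_mass (c s))"
      by (simp add: K_def a_def)
    also have "\<dots> \<le> a * (1 + L + c s)"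
      using a green_mass_bounds(2)[OF c, of s] by (intro mult_left_mono) auto
    finally have "\<bar>F s x\<bar> \<le> P * (a * (1 + L + c s) + C)"
      unfolding F_def abs_mult using p_le[OF c, of s] P by (intro mult_mono) auto
    then show ?thesis by (simp add: algebra_simps)
  qed
  have F_bound: "\<bar>F s x\<bar> \<le> P * (a * (1 + L) + C) + P * a" for s x
  proof -
    have "P * a * c s \<le> P * a * 1" using c[of s] P a by (intro mult_left_mono) auto
    then show ?thesis using F_le[of s x] by simp
  qed
  obtain u where contu: "continuous_on J u"
    and u: "\<And>t. t \<in> J \<Longrightarrow> u t =
      B (\<lambda>t. integral J (\<lambda>s. green t s * F s (u s))) + integral J (\<lambda>s. green t s * F s (u s))"
    using boundary_solution[OF contF F_bound B] by blast
  define y where "y s = F s (u s)" for s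
  define v where "v = (\<lambda>t. integral J (\<lambda>s. green t s * y s))"
  have uv: "u t = B v + v t" if "t \<in> J" for t
    using u[OF that] by (simp add: v_def y_def)
  have conty: "continuous_on J y"
    unfolding y_def by (intro continuous_on_uncurried_compose[OF contF] contu continuous_intros)
  have contv: "continuous_on J v"
    unfolding v_def by (rule continuous_green_integral[OF conty])
  have v_le: "\<bar>v t\<bar> \<le> P / 1440 * ((a * (1 + L) + C) * green_mass t + a * (11 / 35))" if "t \<in> J" for t
  proof -
    have "\<bar>y s\<bar> \<le> P * (a * (1 + L) + C) + P * a * s" if "s \<in> J" for s
      using F_le[of s "u s"] by (simp add: y_def c_id[OF that])
    then have "\<bar>v t\<bar> \<le> (P * (a * (1 + L) + C) * green_mass t + P * a * (11 / 35)) / 1440"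
      unfolding v_def using P a by (intro green_potential_le conty that) auto
    then show ?thesis by (simp add: algebra_simps add_divide_distrib)
  qed
  have "\<bar>u t\<bar> \<le> K t" if t: "t \<in> J" for t
  proof -
    let ?q = "green_mass t"
    have q: "0 \<le> ?q" "?q \<le> 1" using green_mass_bounds[OF t] t by auto
    have "\<bar>v s\<bar> \<le> P / 1440 * (a * (1 + L) + C + a * (11 / 35))" if "s \<in> J" for s
    proof -
      have "(a * (1 + L) + C) * green_mass s \<le> (a * (1 + L) + C) * 1"
        using green_mass_bounds[OF that] that a L0 C(1) by (intro mult_left_mono) auto
      then show ?thesis
        using P by (intro order.trans[OF v_le[OF that]] mult_left_mono) auto
    qed
    then have "\<bar>B v\<bar> \<le> L * (P / 1440 * (a * (1 + L) + C + a * (11 / 35)))"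
      by (rule B_le[OF contv])
    then have "\<bar>u t\<bar> \<le> L * (P / 1440 * (a * (1 + L) + C + a * (11 / 35)))
        + P / 1440 * ((a * (1 + L) + C) * ?q + a * (11 / 35))"
      unfolding uv[OF t] by (intro order.trans[OF abs_triangle_ineq] add_mono v_le[OF t])
    \<comment> \<open>The factor \<open>1 + L\<close> is common to the terms with \<open>a\<close>:
      they come from (1 + L)(L + q) and from 11/35 counted \<open>L\<close> times through
      \<open>B v\<close> and once through \<open>v t\<close>.\<close>
    also have "\<dots> = M * (a * (?q + L + 11 / 35)) + P / 1440 * C * (L + ?q)"
      by (simp add: M_def field_simps)
    also have "\<dots> \<le> M * (a * (?q + L + 11 / 35)) + P / 1440 * C * (L + 1)"
      using q P C(1) by (intro add_left_mono mult_left_mono) auto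
    also have "\<dots> = R * (M * \<bar>\<gamma>\<bar>) * (?q + L + 11 / 35) + R * (M * \<epsilon>) * (?q + L + 11 / 35) + M * C"
      by (simp add: M_def a_def field_simps)
    also have "\<dots> \<le> R * 1 * (?q + L + 11 / 35) + R * (M * \<epsilon>) * N + 12 / 35 * R"
    proof (intro add_mono mult_right_mono mult_left_mono \<gamma>)
      show "M * C \<le> 12 / 35 * R" by (simp add: R_def)
    qed (use q L0 R M \<epsilon> in \<open>auto simp: N_def\<close>)
    also have "R * (M * \<epsilon>) * N = R * (12 / 35)"
      using \<epsilon>(2) by (simp add: mult.assoc)
    \<comment> \<open>The three fractions 11/35, 12/35 and 12/35 add up to 1, which is exactly the
      constant term of the truncation level.\<close>
    also have "R * 1 * (?q + L + 11 / 35) + R * (12 / 35) + 12 / 35 * R = K t"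
      using c_id[OF t] by (simp add: K_def algebra_simps)
    finally show ?thesis .
  qed
  then have "T t (u t) = u t" if "t \<in> J" for t
    using that by (fastforce simp: T_def abs_le_iff)
  then have y_eq: "y t = f t (u t)" if "t \<in> J" for t
    using that f c_id[OF that] by (simp add: y_def F_def)
  have sol: "bvp_solution m \<eta> \<alpha> \<beta> f u"
    using uv y_eq
    by (intro bvp_solution_from_potential[OF assms(2-5) conty v_def]) (simp_all add: B_def \<mu>_def)
  have "nontrivial u"
  proof (rule ccontr)
    assume "\<not> nontrivial u"
    then have u0: "u t = 0" if "t \<in> J" for t using that by (auto simp: nontrivial_def)
    \<comment> \<open>The regularity lemma gives the sixth derivative on all of \<open>J\<close>;
      the equation in \<open>bvp_solution\<close> would not cover the endpoint \<open>1\<close>,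
      which \<open>t\<^sub>0\<close> may be.\<close>
    have "nderiv 6 u t\<^sub>0 = - y t\<^sub>0"
      using uv t0 by (intro green_potential_regularity(2)[OF conty]) (auto simp: v_def)
    moreover have "nderiv 6 u t\<^sub>0 = 0"
      using nderiv_eq[of u "\<lambda>_ _. 0" 6 6, OF u0] t0 by auto
    ultimately show False
      using pg0 f t0 u0[OF t0] y_eq[OF t0] by auto
  qed
  with sol contu show ?thesis by blast
qed

end
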